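(* Let $f:\mathbb{R}\to\mathbb{R}$ be continuous with $\lim_{|x|\to\infty} f(x)/x=0$, let $k=(k(n))_{n\ge 0}$ be a real sequence with $\sum_{j=0}^\infty |k(j)|<+\infty$, let $(H(n))_{n\ge 1}$ be a real sequence, let $\xi\in\mathbb{R}$, and let $(x(n))_{n\ge 0}$ be the real sequence defined by $x(0)=\xi$ and $$x(n+1)=H(n+1)+\sum_{j=0}^n k(n-j)f(x(j)),\quad n\ge 0.$$ Let $p\ge 1$. Then the following are equivalent: (i) $\displaystyle\limsup_{n\to\infty}\frac1n\sum_{j=1}^n|H(j)|^p<+\infty$; (ii) $\displaystyle\limsup_{n\to\infty}\frac1n\sum_{j=1}^n|x(j)|^p<+\infty$. *)

theory Defs
  imports Complex_Main "HOL-Library.Extended_Real"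
begin

end

theory Submission
  imports Defs "HOL-Analysis.Convex" "HOL-Analysis.Elementary_Normed_Spaces"
begin

text \<open>
  The nonlinear convolution \<open>y (n + 1) = (\<Sum>j\<le>n. k (n - j) * f (x j))\<close> is the difference
  of \<open>x (n + 1)\<close> and \<open>H (n + 1)\<close>, so it suffices to show that, in \<open>p\<close>-th mean, \<open>y\<close> is
  negligible compared with \<open>x\<close>. Two facts give this. Convolution with a summable kernel is bounded
  on \<open>\<ell>\<^sup>p\<close>, with norm at most \<open>\<Sum>j. \<bar>k j\<bar>\<close> and uniformly over the initial segments
  (\<open>discrete_Young_inequality\<close>). Sublinear growth and continuity of \<open>f\<close> give, for each
  \<open>\<epsilon> > 0\<close>, a constant \<open>C\<close> with \<open>\<bar>f u\<bar> \<le> max C (\<epsilon> * \<bar>u\<bar>)\<close>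
  (\<open>sublinear_bound\<close>). Together they bound the sum of \<open>\<bar>y j\<bar> powr p\<close> up to \<open>N\<close> by an
  arbitrarily small multiple of the corresponding sum for \<open>x\<close>, plus \<open>O(N)\<close>
  (\<open>sublinear_convolution_powr_sum_bound\<close>).

  If \<open>x\<close> is bounded in \<open>p\<close>-th mean, then so is \<open>y\<close>, hence \<open>H = x - y\<close>. Conversely, if
  \<open>H\<close> is bounded in \<open>p\<close>-th mean, then in \<open>x = H + y\<close> the contribution of \<open>y\<close> can be
  absorbed into the left-hand side: choosing the small multiple to be \<open>1 / (2 * 2 powr p)\<close> makes it at
  most half of the sum for \<open>x\<close>. Absorption is legitimate since every sum in question is finite.
\<close>

section \<open>Jensen and Young inequalities for powers\<close>

lemma abs_add_powr_le:
  fixes a b p :: real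
  assumes "p \<ge> 0"
  shows "\<bar>a + b\<bar> powr p \<le> 2 powr p * (\<bar>a\<bar> powr p + \<bar>b\<bar> powr p)"
proof -
  have "\<bar>a + b\<bar> powr p \<le> (2 * max \<bar>a\<bar> \<bar>b\<bar>) powr p"
    using assms by (intro powr_mono2) auto
  also have "\<dots> = 2 powr p * max \<bar>a\<bar> \<bar>b\<bar> powr p"
    by (simp add: powr_mult)
  also have "\<dots> \<le> 2 powr p * (\<bar>a\<bar> powr p + \<bar>b\<bar> powr p)"
    by (intro mult_left_mono) (auto simp: max_def)
  finally show ?thesis .
qed

text \<open>
  Jensen's inequality for \<open>t \<mapsto> t powr p\<close> with unnormalised weights. The factor
  \<open>K powr (p - 1)\<close> is the price of the normalisation.
\<close>

lemma weighted_sum_powr_le: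
  fixes w a :: "'a \<Rightarrow> real" and K p :: real
  assumes p: "p \<ge> 1" and fin: "finite S"
    and w: "\<And>i. i \<in> S \<Longrightarrow> w i \<ge> 0" and a: "\<And>i. i \<in> S \<Longrightarrow> a i \<ge> 0"
    and K: "(\<Sum>i\<in>S. w i) \<le> K"
  shows "(\<Sum>i\<in>S. w i * a i) powr p \<le> K powr (p - 1) * (\<Sum>i\<in>S. w i * a i powr p)"
proof -
  \<comment> \<open>The power function is convex on the open half-line, so only positive terms enter Jensen.\<close>
  define T where "T = {i \<in> S. w i > 0 \<and> a i > 0}"
  define V where "V = (\<Sum>i\<in>T. w i)"
  have finT: "finite T" and sub: "T \<subseteq> S"
    using fin by (auto simp: T_def)
  have eq1: "(\<Sum>i\<in>S. w i * a i) = (\<Sum>i\<in>T. w i * a i)"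
    by (rule sum.mono_neutral_right[OF fin sub]) (use w a in \<open>force simp: T_def\<close>)
  have eq2: "(\<Sum>i\<in>S. w i * a i powr p) = (\<Sum>i\<in>T. w i * a i powr p)"
    by (rule sum.mono_neutral_right[OF fin sub]) (use w a in \<open>force simp: T_def\<close>)
  have nonneg: "(\<Sum>i\<in>T. w i * a i powr p) \<ge> 0"
    by (intro sum_nonneg) (auto simp: T_def)
  show ?thesis
  proof (cases "T = {}")
    case True
    then show ?thesis by (simp add: eq1 eq2)
  next
    case False
    have V: "V > 0"
      unfolding V_def using finT False by (intro sum_pos) (auto simp: T_def)
    have "V \<le> (\<Sum>i\<in>S. w i)"
      unfolding V_def using fin sub w by (intro sum_mono2) auto
    with K have VK: "V \<le> K" by simp
    have "(\<Sum>i\<in>T. (w i / V) *\<^sub>R a i) powr p \<le> (\<Sum>i\<in>T. (w i / V) * a i powr p)"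
    proof (rule convex_on_sum[OF finT False powr_convex[OF p]])
      show "(\<Sum>i\<in>T. w i / V) = 1"
        using V by (simp add: V_def flip: sum_divide_distrib)
    qed (use V in \<open>auto simp: T_def\<close>)
    moreover have "(\<Sum>i\<in>T. (w i / V) *\<^sub>R a i) = (\<Sum>i\<in>T. w i * a i) / V"
      by (simp add: sum_divide_distrib)
    moreover have "(\<Sum>i\<in>T. (w i / V) * a i powr p) = (\<Sum>i\<in>T. w i * a i powr p) / V"
      by (simp add: sum_divide_distrib)
    ultimately have "((\<Sum>i\<in>T. w i * a i) / V) powr p \<le> (\<Sum>i\<in>T. w i * a i powr p) / V"
      by simp
    moreover have "(\<Sum>i\<in>T. w i * a i) \<ge> 0"
      by (intro sum_nonneg) (auto simp: T_def)
    ultimately have "(\<Sum>i\<in>T. w i * a i) powr p \<le> V powr (p - 1) * (\<Sum>i\<in>T. w i * a i powr p)"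
      using V by (simp add: powr_divide powr_diff field_simps)
    also have "\<dots> \<le> K powr (p - 1) * (\<Sum>i\<in>T. w i * a i powr p)"
      using V VK p nonneg by (intro mult_right_mono powr_mono2) auto
    finally show ?thesis by (simp add: eq1 eq2)
  qed
qed

text \<open>
  Young's inequality \<open>\<parallel>k * g\<parallel>\<^sub>p \<le> \<parallel>k\<parallel>\<^sub>1 \<parallel>g\<parallel>\<^sub>p\<close>. It passes to initial
  segments because the convolution is causal: its first \<open>N\<close> terms involve only the first \<open>N\<close>
  terms of \<open>g\<close>.
\<close>

lemma discrete_Young_inequality:
  fixes k g :: "nat \<Rightarrow> real" and p :: real
  assumes p: "p \<ge> 1" and k: "summable (\<lambda>j. \<bar>k j\<bar>)"
  shows "(\<Sum>n<N. \<bar>\<Sum>j\<le>n. k (n - j) * g j\<bar> powr p)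
          \<le> (\<Sum>j. \<bar>k j\<bar>) powr p * (\<Sum>j<N. \<bar>g j\<bar> powr p)"
proof -
  define K where "K = (\<Sum>j. \<bar>k j\<bar>)"
  have K0: "K \<ge> 0" unfolding K_def by (intro suminf_nonneg k) auto
  have partial: "(\<Sum>j\<in>A. \<bar>k j\<bar>) \<le> K" if "finite A" for A
    unfolding K_def using that by (intro sum_le_suminf k) auto
  have pointwise: "\<bar>\<Sum>j\<le>n. k (n - j) * g j\<bar> powr p
      \<le> K powr (p - 1) * (\<Sum>j\<le>n. \<bar>k (n - j)\<bar> * \<bar>g j\<bar> powr p)" for n
  proof -
    have "(\<Sum>j\<le>n. \<bar>k (n - j)\<bar>) = (\<Sum>j\<le>n. \<bar>k j\<bar>)"
      using sum.nat_diff_reindex[of "\<lambda>j. \<bar>k j\<bar>" "Suc n"] by (simp add: lessThan_Suc_atMost)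
    also have "\<dots> \<le> K"
      by (rule partial) simp
    finally have total: "(\<Sum>j\<le>n. \<bar>k (n - j)\<bar>) \<le> K" .
    have "\<bar>\<Sum>j\<le>n. k (n - j) * g j\<bar> \<le> (\<Sum>j\<le>n. \<bar>k (n - j)\<bar> * \<bar>g j\<bar>)"
      using sum_abs[of "\<lambda>j. k (n - j) * g j" "{..n}"] by (simp add: abs_mult)
    then have "\<bar>\<Sum>j\<le>n. k (n - j) * g j\<bar> powr p \<le> (\<Sum>j\<le>n. \<bar>k (n - j)\<bar> * \<bar>g j\<bar>) powr p"
      using p by (intro powr_mono2) auto
    also have "\<dots> \<le> K powr (p - 1) * (\<Sum>j\<le>n. \<bar>k (n - j)\<bar> * \<bar>g j\<bar> powr p)"
      by (rule weighted_sum_powr_le[OF p]) (use total in auto)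
    finally show ?thesis .
  qed
  have "(\<Sum>n<N. \<Sum>j\<le>n. \<bar>k (n - j)\<bar> * \<bar>g j\<bar> powr p)
      = (\<Sum>(j, i)\<in>{(j, i). j + i < N}. \<bar>k i\<bar> * \<bar>g j\<bar> powr p)"
    by (rule sum.triangle_reindex[symmetric])
  also have "\<dots> \<le> (\<Sum>(j, i)\<in>{..<N} \<times> {..<N}. \<bar>k i\<bar> * \<bar>g j\<bar> powr p)"
    by (intro sum_mono2) auto
  also have "\<dots> = (\<Sum>i<N. \<bar>k i\<bar>) * (\<Sum>j<N. \<bar>g j\<bar> powr p)"
    unfolding sum_product sum.cartesian_product[symmetric] by (rule sum.swap)
  also have "\<dots> \<le> K * (\<Sum>j<N. \<bar>g j\<bar> powr p)"
    by (intro mult_right_mono partial sum_nonneg) auto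
  finally have double: "(\<Sum>n<N. \<Sum>j\<le>n. \<bar>k (n - j)\<bar> * \<bar>g j\<bar> powr p)
      \<le> K * (\<Sum>j<N. \<bar>g j\<bar> powr p)" .
  have "(\<Sum>n<N. \<bar>\<Sum>j\<le>n. k (n - j) * g j\<bar> powr p)
      \<le> K powr (p - 1) * (\<Sum>n<N. \<Sum>j\<le>n. \<bar>k (n - j)\<bar> * \<bar>g j\<bar> powr p)"
    unfolding sum_distrib_left[where A = "{..<N}"] by (intro sum_mono pointwise)
  also have "\<dots> \<le> K powr (p - 1) * (K * (\<Sum>j<N. \<bar>g j\<bar> powr p))"
    by (intro mult_left_mono double) auto
  also have "\<dots> = K powr p * (\<Sum>j<N. \<bar>g j\<bar> powr p)"
    using K0 by (cases "K = 0") (auto simp: powr_diff)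
  finally show ?thesis unfolding K_def .
qed

section \<open>Sublinear nonlinearities\<close>

text \<open>
  Outside a large interval \<open>f\<close> is below \<open>\<epsilon> * \<bar>u\<bar>\<close>, and inside it is bounded by
  compactness. Stating the bound with a maximum rather than a sum keeps the coefficient of
  \<open>\<bar>u\<bar> powr p\<close> equal to \<open>\<epsilon> powr p\<close> after taking powers.
\<close>

lemma sublinear_bound:
  fixes f :: "real \<Rightarrow> real"
  assumes cont: "continuous_on UNIV f" and lim: "((\<lambda>u. f u / u) \<longlongrightarrow> 0) at_infinity"
    and "\<epsilon> > 0"
  obtains C where "C \<ge> 0" "\<And>u. \<bar>f u\<bar> \<le> max C (\<epsilon> * \<bar>u\<bar>)"
proof -
  have "eventually (\<lambda>u. \<bar>f u / u\<bar> < \<epsilon>) at_infinity"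
    using tendstoD[OF lim \<open>\<epsilon> > 0\<close>] by simp
  then obtain b where b: "\<And>u. \<bar>u\<bar> \<ge> b \<Longrightarrow> \<bar>f u / u\<bar> < \<epsilon>"
    by (auto simp: eventually_at_infinity)
  have "compact (f ` {- b..b})"
    by (rule compact_continuous_image[OF continuous_on_subset[OF cont]]) auto
  then have "\<exists>C. \<forall>u\<in>{- b..b}. \<bar>f u\<bar> \<le> C"
    by (auto dest!: compact_imp_bounded simp: bounded_iff)
  then obtain C where C: "\<And>u. u \<in> {- b..b} \<Longrightarrow> \<bar>f u\<bar> \<le> C"
    by blast
  show ?thesis
  proof (rule that)
    show "max (max C \<bar>f 0\<bar>) 0 \<ge> 0" by simp
    fix u
    \<comment> \<open>The origin needs care: if \<open>b \<le> 0\<close> it lies in the outer region, where \<open>f 0 / 0 = 0\<close>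
      says nothing about \<open>f 0\<close>.\<close>
    consider "u = 0" | "u \<noteq> 0" "\<bar>u\<bar> \<ge> b" | "u \<in> {- b..b}" by fastforce
    then show "\<bar>f u\<bar> \<le> max (max (max C \<bar>f 0\<bar>) 0) (\<epsilon> * \<bar>u\<bar>)"
    proof cases
      case 2
      then have "\<bar>f u\<bar> \<le> \<epsilon> * \<bar>u\<bar>"
        using b[of u] by (simp add: abs_divide divide_less_eq split: if_splits)
      then show ?thesis by simp
    next
      case 3
      then show ?thesis using C[of u] by linarith
    qed auto
  qed
qed

lemma sublinear_convolution_powr_sum_bound:
  fixes f :: "real \<Rightarrow> real" and k x :: "nat \<Rightarrow> real" and p \<theta> :: real
  assumes cont: "continuous_on UNIV f" and lim: "((\<lambda>u. f u / u) \<longlongrightarrow> 0) at_infinity"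
    and k: "summable (\<lambda>j. \<bar>k j\<bar>)" and p: "p \<ge> 1" and \<theta>: "\<theta> > 0"
  obtains D where "\<And>N. (\<Sum>n<N. \<bar>\<Sum>j\<le>n. k (n - j) * f (x j)\<bar> powr p)
                        \<le> \<theta> * (\<Sum>j<N. \<bar>x j\<bar> powr p) + D * real N"
proof -
  define L where "L = (\<Sum>j. \<bar>k j\<bar>) powr p"
  have L0: "L \<ge> 0" by (simp add: L_def)
  \<comment> \<open>Chosen so that \<open>L * \<epsilon> powr p \<le> \<theta>\<close>; the summand 1 allows for a vanishing kernel.\<close>
  define \<epsilon> where "\<epsilon> = (\<theta> / (L + 1)) powr (1 / p)"
  have "\<epsilon> > 0" using \<theta> L0 by (simp add: \<epsilon>_def)
  then obtain C where C: "C \<ge> 0" "\<And>u. \<bar>f u\<bar> \<le> max C (\<epsilon> * \<bar>u\<bar>)"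
    using sublinear_bound[OF cont lim] by blast
  have "\<epsilon> powr p = \<theta> / (L + 1)"
    using \<theta> L0 p by (simp add: \<epsilon>_def powr_powr)
  then have "L * \<epsilon> powr p + \<epsilon> powr p = \<theta>"
    using L0 by (simp add: field_simps)
  then have small: "L * \<epsilon> powr p \<le> \<theta>"
    using powr_ge_zero[of \<epsilon> p] by linarith
  have fp: "\<bar>f u\<bar> powr p \<le> C powr p + \<epsilon> powr p * \<bar>u\<bar> powr p" for u
  proof -
    have "\<bar>f u\<bar> powr p \<le> max C (\<epsilon> * \<bar>u\<bar>) powr p"
      using p C by (intro powr_mono2) auto
    also have "\<dots> \<le> C powr p + (\<epsilon> * \<bar>u\<bar>) powr p"
      by (auto simp: max_def)
    finally show ?thesis using \<open>\<epsilon> > 0\<close> by (simp add: powr_mult)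
  qed
  show ?thesis
  proof (rule that)
    fix N
    have "(\<Sum>n<N. \<bar>\<Sum>j\<le>n. k (n - j) * f (x j)\<bar> powr p) \<le> L * (\<Sum>j<N. \<bar>f (x j)\<bar> powr p)"
      unfolding L_def by (rule discrete_Young_inequality[OF p k])
    also have "\<dots> \<le> L * (\<Sum>j<N. C powr p + \<epsilon> powr p * \<bar>x j\<bar> powr p)"
      by (intro mult_left_mono sum_mono fp L0)
    also have "\<dots> = (L * \<epsilon> powr p) * (\<Sum>j<N. \<bar>x j\<bar> powr p) + (L * C powr p) * real N"
      by (simp add: sum.distrib sum_distrib_left algebra_simps)
    also have "\<dots> \<le> \<theta> * (\<Sum>j<N. \<bar>x j\<bar> powr p) + (L * C powr p) * real N"
      by (intro add_right_mono mult_right_mono small sum_nonneg) auto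
    finally show "(\<Sum>n<N. \<bar>\<Sum>j\<le>n. k (n - j) * f (x j)\<bar> powr p)
        \<le> \<theta> * (\<Sum>j<N. \<bar>x j\<bar> powr p) + (L * C powr p) * real N" .
  qed
qed

section \<open>Boundedness in mean\<close>

lemma limsup_average_finite_iff:
  fixes S :: "nat \<Rightarrow> real"
  shows "limsup (\<lambda>n. ereal (1 / real n * S n)) < \<infinity>
    \<longleftrightarrow> (\<exists>B. eventually (\<lambda>n. S n \<le> B * real n) sequentially)"
proof
  assume "limsup (\<lambda>n. ereal (1 / real n * S n)) < \<infinity>"
  then obtain B where "limsup (\<lambda>n. ereal (1 / real n * S n)) < ereal B"
    using less_PInf_Ex_of_nat by auto
  then have "eventually (\<lambda>n. ereal (1 / real n * S n) < ereal B) sequentially"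
    by (rule Limsup_lessD)
  then have "eventually (\<lambda>n. S n \<le> B * real n) sequentially"
    using eventually_gt_at_top[of 0]
    by eventually_elim (simp add: field_simps)
  then show "\<exists>B. eventually (\<lambda>n. S n \<le> B * real n) sequentially" ..
next
  assume "\<exists>B. eventually (\<lambda>n. S n \<le> B * real n) sequentially"
  then obtain B where "eventually (\<lambda>n. S n \<le> B * real n) sequentially" ..
  then have "eventually (\<lambda>n. ereal (1 / real n * S n) \<le> ereal B) sequentially"
    using eventually_gt_at_top[of 0]
    by eventually_elim (simp add: field_simps)
  then have "limsup (\<lambda>n. ereal (1 / real n * S n)) \<le> ereal B"
    by (rule Limsup_bounded)
  then show "limsup (\<lambda>n. ereal (1 / real n * S n)) < \<infinity>"
    by (rule le_less_trans) simp
qed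

text \<open>
  The form in which boundedness in mean is transferred between \<open>x\<close> and \<open>H\<close>; the constant term
  \<open>a\<close> accounts for the initial value \<open>x 0\<close>.
\<close>

lemma limsup_average_finite_transfer:
  fixes S T :: "nat \<Rightarrow> real"
  assumes "limsup (\<lambda>n. ereal (1 / real n * S n)) < \<infinity>"
    and "c \<ge> 0" and a: "a \<ge> 0" and le: "\<And>n. T n \<le> c * S n + d * real n + a"
  shows "limsup (\<lambda>n. ereal (1 / real n * T n)) < \<infinity>"
proof -
  obtain B where "eventually (\<lambda>n. S n \<le> B * real n) sequentially"
    using assms(1) limsup_average_finite_iff by blast
  then have "eventually (\<lambda>n. T n \<le> (c * B + d + a) * real n) sequentially"
    using eventually_gt_at_top[of 0]
  proof eventually_elim
    case (elim n)
    have "c * S n \<le> c * (B * real n)"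
      using elim \<open>c \<ge> 0\<close> by (intro mult_left_mono)
    moreover have "a \<le> a * real n"
      using elim a by (simp add: mult_le_cancel_left1)
    ultimately show ?case using le[of n] by (simp add: algebra_simps)
  qed
  then show ?thesis unfolding limsup_average_finite_iff ..
qed

theorem theorem17:
  fixes f :: "real \<Rightarrow> real" and k H x :: "nat \<Rightarrow> real" and \<xi> p :: real
  assumes "continuous_on UNIV f"
    and "((\<lambda>u. f u / u) \<longlongrightarrow> 0) at_infinity"
    and "summable (\<lambda>j. \<bar>k j\<bar>)"
    and "x 0 = \<xi>"
    and "\<And>n. x (n + 1) = H (n + 1) + (\<Sum>j=0..n. k (n - j) * f (x j))"
    and "p \<ge> 1"
  shows "limsup (\<lambda>n. ereal (1 / real n * (\<Sum>j=1..n. \<bar>H j\<bar> powr p))) < \<infinity>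
     \<longleftrightarrow> limsup (\<lambda>n. ereal (1 / real n * (\<Sum>j=1..n. \<bar>x j\<bar> powr p))) < \<infinity>"
proof -
  define q :: real where "q = 2 powr p"
  have q: "q > 0" by (simp add: q_def)
  define y where "y n = (\<Sum>j\<le>n. k (n - j) * f (x j))" for n
  define SH where "SH N = (\<Sum>j=1..N. \<bar>H j\<bar> powr p)" for N
  define SX where "SX N = (\<Sum>j=1..N. \<bar>x j\<bar> powr p)" for N
  define SY where "SY N = (\<Sum>n<N. \<bar>y n\<bar> powr p)" for N
  have SH: "SH N = (\<Sum>n<N. \<bar>H (Suc n)\<bar> powr p)" for N
    by (simp add: SH_def sum.atLeast1_atMost_eq)
  have SX: "SX N = (\<Sum>n<N. \<bar>x (Suc n)\<bar> powr p)" for N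
    by (simp add: SX_def sum.atLeast1_atMost_eq)
  have rec: "x (Suc n) = H (Suc n) + y n" for n
    using assms(5)[of n] by (simp add: y_def atMost_atLeast0)
  have initial: "(\<Sum>j<N. \<bar>x j\<bar> powr p) \<le> \<bar>\<xi>\<bar> powr p + SX N" for N
  proof -
    have "(\<Sum>j<N. \<bar>x j\<bar> powr p) \<le> (\<Sum>j<Suc N. \<bar>x j\<bar> powr p)"
      by simp
    also have "\<dots> = \<bar>\<xi>\<bar> powr p + SX N"
      using assms(4) by (simp only: sum.lessThan_Suc_shift SX)
    finally show ?thesis .
  qed
  have "1 / (2 * q) > 0" using q by simp
  then obtain D where D: "\<And>N. SY N \<le> 1 / (2 * q) * (\<Sum>j<N. \<bar>x j\<bar> powr p) + D * real N"
    unfolding SY_def y_def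
    using sublinear_convolution_powr_sum_bound[OF assms(1-3,6)] by blast
  have qSY: "q * SY N \<le> SX N / 2 + \<bar>\<xi>\<bar> powr p / 2 + (q * D) * real N" for N
  proof -
    have "SY N \<le> 1 / (2 * q) * (\<bar>\<xi>\<bar> powr p + SX N) + D * real N"
      using D[of N] mult_left_mono[OF initial[of N], of "1 / (2 * q)"] q by simp
    then show ?thesis using q by (simp add: field_simps)
  qed
  have x_bound: "SX N \<le> q * SH N + q * SY N" for N
  proof -
    have "SX N \<le> (\<Sum>n<N. q * (\<bar>H (Suc n)\<bar> powr p + \<bar>y n\<bar> powr p))"
      unfolding SX rec q_def using assms(6) by (intro sum_mono abs_add_powr_le) simp
    then show ?thesis
      by (simp add: SH SY_def sum.distrib sum_distrib_left algebra_simps)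
  qed
  \<comment> \<open>Half of the sum for \<open>x\<close> is absorbed into the left-hand side.\<close>
  have x_le: "SX N \<le> (2 * q) * SH N + (2 * q * D) * real N + \<bar>\<xi>\<bar> powr p" for N
    using x_bound[of N] qSY[of N] by (simp add: algebra_simps)
  have H_bound: "SH N \<le> q * SX N + q * SY N" for N
  proof -
    have "SH N \<le> (\<Sum>n<N. q * (\<bar>x (Suc n)\<bar> powr p + \<bar>y n\<bar> powr p))"
      unfolding SH q_def
    proof (rule sum_mono)
      fix n
      show "\<bar>H (Suc n)\<bar> powr p \<le> 2 powr p * (\<bar>x (Suc n)\<bar> powr p + \<bar>y n\<bar> powr p)"
        using abs_add_powr_le[of p "x (Suc n)" "- y n"] assms(6) rec[of n] by simp
    qed
    then show ?thesis
      by (simp add: SX SY_def sum.distrib sum_distrib_left algebra_simps)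
  qed
  have H_le: "SH N \<le> (q + 1 / 2) * SX N + (q * D) * real N + \<bar>\<xi>\<bar> powr p / 2" for N
    using H_bound[of N] qSY[of N] by (simp add: algebra_simps)
  show ?thesis
    unfolding SH_def[symmetric] SX_def[symmetric]
    using limsup_average_finite_transfer[OF _ _ _ x_le] limsup_average_finite_transfer[OF _ _ _ H_le] q
    by auto
qed

end
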